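(* Let $G=(V,E)$ be an infinite, connected, locally finite graph satisfying the following for some $d\ge2$ and constants $c_{\mathrm{reg}},C_{\mathrm{reg}},C_{\mathrm{riso}}\in(0,\infty)$, $C_{\mathrm W}\in[1,\infty)$, for all $x\in V$: (i) there exists $N_1(x)<\infty$ such that $c_{\mathrm{reg}}n^d\le|B(x,n)|\le C_{\mathrm{reg}}n^d$ for all $n\ge N_1(x)$; (ii) there exist $N_2(x)<\infty$ and an increasing sequence $\{\mathcal S(x,n)\subset V:n\in\mathbb N\}$ of connected sets such that for all $n\ge N_2(x)$: $B(x,n)\subset\mathcal S(x,n)\subset B(x,C_{\mathrm W}n)$, and $|\partial_{\mathcal S(x,n)}A|\ge C_{\mathrm{riso}}\,n^{-1}|A|$ for all $A\subset\mathcal S(x,n)$ with $|A|\le\frac12|\mathcal S(x,n)|$. For any $x\in V$ and $\varepsilon\in(0,1)$, choose $n$ large enough such that $\lfloor n^{(1-\varepsilon)/(d-\varepsilon)}\rfloor\ge N_1(x)\vee N_2(x)$. Further, assume that the edge weight $w_n:E\to(0,\infty)$ satisfies $$w_n(\{y,y'\})\ \ge\ \Big(\frac{n}{\max\{d_G(x,y),d_G(x,y')\}}\Big)^{d-\varepsilon}\qquad\forall\,\{y,y'\}\in E.$$ Then there exists $C_2\in(0,\infty)$ such that $$|\partial_{\mathcal S(x,n)}A|_{w_n}\ \ge\ \frac{C_2}{n}\,|A|\qquad\forall\,A\subset\mathcal S(x,n)\setminus\{x\}.$$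
   Context: $d_G$ is the graph distance on $G$, and $B(x,r)=\{y\in V:d_G(x,y)\le\lfloor r\rfloor\}$. $|A|$ is the cardinality of $A\subset V$. For $A\subset B\subset V$, the relative boundary is $\partial_BA=\{\{y,y'\}\in E:y\in A,\ y'\in B\setminus A\}$, with cardinality $|\partial_BA|$, and for an edge weight $w:E\to(0,\infty)$, $|\partial_BA|_w:=\sum_{e\in\partial_BA}w(e)$. $n$ ranges over positive integers; $a\vee b=\max\{a,b\}$. *)

theory Defs
  imports Complex_Main
begin

text \<open>A graph is given by a vertex set \<open>V\<close> and a set \<open>E\<close> of unordered edges \<open>{y, y'}\<close> with
  \<open>y \<noteq> y'\<close>.\<close>

definition simple_graph :: "'a set \<Rightarrow> 'a set set \<Rightarrow> bool" where
  "simple_graph V E \<longleftrightarrow> (\<forall>e\<in>E. e \<subseteq> V \<and> card e = 2)"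

definition locally_finite_graph :: "'a set \<Rightarrow> 'a set set \<Rightarrow> bool" where
  "locally_finite_graph V E \<longleftrightarrow> (\<forall>x\<in>V. finite {e \<in> E. x \<in> e})"

definition adj :: "'a set set \<Rightarrow> ('a \<times> 'a) set" where
  "adj E = {(y, y'). {y, y'} \<in> E}"

text \<open>Connectedness of the subgraph induced on \<open>A\<close>; the whole graph is connected iff
  \<open>connected_in E V\<close>. The empty set counts as connected.\<close>

definition connected_in :: "'a set set \<Rightarrow> 'a set \<Rightarrow> bool" where
  "connected_in E A \<longleftrightarrow> (\<forall>y\<in>A. \<forall>y'\<in>A. (y, y') \<in> (adj E \<inter> A \<times> A)\<^sup>*)"

text \<open>Only meaningful for vertices joined by a path; otherwise the \<open>LEAST\<close> is unspecified.\<close>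

definition graph_dist :: "'a set set \<Rightarrow> 'a \<Rightarrow> 'a \<Rightarrow> nat" where
  "graph_dist E x y = (LEAST k. (x, y) \<in> adj E ^^ k)"

definition graph_ball :: "'a set \<Rightarrow> 'a set set \<Rightarrow> 'a \<Rightarrow> real \<Rightarrow> 'a set" where
  "graph_ball V E x r = {y \<in> V. int (graph_dist E x y) \<le> \<lfloor>r\<rfloor>}"

definition rel_boundary :: "'a set set \<Rightarrow> 'a set \<Rightarrow> 'a set \<Rightarrow> 'a set set" where
  "rel_boundary E B A = {{y, y'} | y y'. {y, y'} \<in> E \<and> y \<in> A \<and> y' \<in> B - A}"

definition rel_boundary_weight ::
    "('a set \<Rightarrow> real) \<Rightarrow> 'a set set \<Rightarrow> 'a set \<Rightarrow> 'a set \<Rightarrow> real" where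
  "rel_boundary_weight w E B A = (\<Sum>e\<in>rel_boundary E B A. w e)"

end

theory Submission
  imports Defs
begin

text \<open>If \<open>A\<close> fills at most half of \<open>S x n\<close>, the relative isoperimetric inequality suffices, since
  the weights on \<open>S x n\<close> are bounded below. Otherwise the complement \<open>B \<ni> x\<close> of \<open>A\<close> has the same
  boundary, and it is enough to bound its weight below by a multiple of \<open>n\<close> to the power \<open>d - 1\<close>.
  Let \<open>k\<close> be the integer part of \<open>n\<close> to the power \<open>(1 - \<epsilon>) / (d - \<epsilon>)\<close> and let
  \<open>m\<close> be the first scale from \<open>k\<close> onwards at which \<open>B\<close> fills at most half of \<open>S x m\<close>.
  If \<open>m = k\<close>, a single boundary edge in \<open>S x m\<close> has the required weight. If \<open>m > k\<close>, then \<open>B\<close>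
  fills more than half of \<open>S x (m - 1)\<close>, so by isoperimetry in \<open>S x m\<close> there are at least of order
  \<open>m\<close> to the power \<open>d - 1\<close> boundary edges, each of weight at least of order \<open>n / m\<close> to the power
  \<open>d - \<epsilon> \<ge> d - 1\<close>.\<close>

section \<open>Relative boundaries, distances and balls\<close>

lemma rel_boundary_compl:
  assumes "A \<subseteq> S"
  shows "rel_boundary E S (S - A) = rel_boundary E S A"
proof -
  have "rel_boundary E S (S - A) \<subseteq> rel_boundary E S A" for A
  proof
    fix e
    assume "e \<in> rel_boundary E S (S - A)"
    then obtain y y' where "e = {y', y}" "{y', y} \<in> E" "y' \<in> A" "y \<in> S - A"
      unfolding rel_boundary_def by (auto simp: insert_commute)
    then show "e \<in> rel_boundary E S A"
      unfolding rel_boundary_def by blast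
  qed
  from this[of A] this[of "S - A"] show ?thesis
    using assms by (simp add: double_diff)
qed

lemma rel_boundary_Int_subset:
  assumes "T \<subseteq> S"
  shows "rel_boundary E T (T \<inter> A) \<subseteq> rel_boundary E S A"
  using assms unfolding rel_boundary_def by blast

lemma finite_rel_boundary:
  assumes "finite S" "A \<subseteq> S"
  shows "finite (rel_boundary E S A)"
  using assms by (intro finite_subset[OF _ finite_Pow_iff[THEN iffD2, of S]])
    (auto simp: rel_boundary_def)

text \<open>Connectedness makes the \<open>LEAST\<close> in \<open>graph_dist\<close> an attained
  path length, and a path of length 0 has equal endpoints.\<close>

lemma graph_dist_pos:
  assumes "connected_in E V" "x \<in> V" "y \<in> V" "x \<noteq> y"
  shows "graph_dist E x y > 0"
proof (rule ccontr)
  assume "\<not> graph_dist E x y > 0"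
  moreover have "(x, y) \<in> (adj E)\<^sup>*"
    using assms rtrancl_mono[of "adj E \<inter> V \<times> V" "adj E"] unfolding connected_in_def by blast
  then have "\<exists>k. (x, y) \<in> adj E ^^ k"
    by (simp add: rtrancl_power)
  then have "(x, y) \<in> adj E ^^ graph_dist E x y"
    unfolding graph_dist_def by (rule LeastI_ex)
  ultimately show False
    using assms by simp
qed

lemma graph_ball_mono:
  assumes "r \<le> s"
  shows "graph_ball V E x r \<subseteq> graph_ball V E x s"
  using floor_mono[OF assms] unfolding graph_ball_def by auto

text \<open>Boundary edges of the trace \<open>T \<inter> B\<close> inside the smaller set
  \<open>T\<close> are also boundary edges of \<open>B\<close> inside \<open>S\<close>. The other
  boundary edges have positive weight and are discarded. This lets isoperimetry at a smaller scale
  bound the weight at scale \<open>n\<close>.\<close>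

lemma rel_boundary_weight_ge_card:
  fixes w :: "'a set \<Rightarrow> real"
  assumes "finite S" "T \<subseteq> S" "B \<subseteq> S"
    and pos: "\<And>e. e \<in> E \<Longrightarrow> w e > 0"
    and lower: "\<And>y y'. {y, y'} \<in> E \<Longrightarrow> y \<in> T \<Longrightarrow> y' \<in> T \<Longrightarrow> w {y, y'} \<ge> c"
  shows "rel_boundary_weight w E S B \<ge> c * real (card (rel_boundary E T (T \<inter> B)))"
proof -
  have "real (card (rel_boundary E T (T \<inter> B))) * c \<le> (\<Sum>e\<in>rel_boundary E T (T \<inter> B). w e)"
    by (rule sum_bounded_below) (auto simp: rel_boundary_def intro!: lower)
  also have "\<dots> \<le> (\<Sum>e\<in>rel_boundary E S B. w e)"
    using assms
    by (intro sum_mono2 finite_rel_boundary rel_boundary_Int_subset)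
      (auto simp: rel_boundary_def intro!: less_imp_le pos)
  finally show ?thesis
    by (simp add: rel_boundary_weight_def mult.commute)
qed

section \<open>Selection of a scale and comparison of powers\<close>

lemma first_sparse_scale:
  fixes k n :: nat
  assumes "k \<le> n" "P n"
  obtains "P k" | m where "k \<le> m" "m < n" "\<not> P m" "P (Suc m)"
proof (cases "P k")
  case False
  with assms show ?thesis
  proof (induction n rule: dec_induct)
    case (step n)
    then show ?case
      using that(2) by (metis less_Suc_eq)
  qed simp
qed (rule that(1))

text \<open>The exponent of the scale is chosen for this: dividing \<open>n\<close> by
  \<open>n powr ((1 - \<epsilon>) / (d - \<epsilon>))\<close> leaves
  \<open>n powr ((d - 1) / (d - \<epsilon>))\<close>, so a single edge at scale \<open>k\<close>
  already has weight of order \<open>n powr (d - 1)\<close>.\<close>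

lemma powr_small_scale:
  fixes n k d \<epsilon> :: real
  assumes "n \<ge> 1" "k > 0" "k \<le> n powr ((1 - \<epsilon>) / (d - \<epsilon>))" "d > \<epsilon>"
  shows "n powr (d - 1) \<le> (n / k) powr (d - \<epsilon>)"
proof -
  have "n powr (d - 1) = (n / n powr ((1 - \<epsilon>) / (d - \<epsilon>))) powr (d - \<epsilon>)"
    using assms by (simp add: powr_divide powr_powr flip: powr_diff)
  also have "\<dots> \<le> (n / k) powr (d - \<epsilon>)"
    using assms by (intro powr_mono2 divide_left_mono) auto
  finally show ?thesis .
qed

text \<open>Replacing \<open>m\<close> by \<open>Suc m \<le> 2 * m\<close> costs the factor
  \<open>(1 / 2) powr d\<close>. Since \<open>n / Suc m \<ge> 1\<close>, its exponent may be raised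
  from \<open>d - 1\<close> to \<open>d - \<epsilon>\<close>, after which the powers of
  \<open>Suc m\<close> cancel.\<close>

lemma powr_large_scale:
  fixes n d \<epsilon> :: real and m :: nat
  assumes "m \<ge> 1" "real (Suc m) \<le> n" "\<epsilon> \<le> 1" "d \<ge> 0"
  shows "n powr (d - 1) * (1 / 2) powr d
    \<le> (n / real (Suc m)) powr (d - \<epsilon>) * (real m powr d / real (Suc m))"
proof -
  have "(1 / 2) powr d * real (Suc m) powr d = (real (Suc m) / 2) powr d"
    by (simp flip: powr_mult)
  also have "\<dots> \<le> real m powr d"
    using assms by (intro powr_mono2) auto
  finally have "(1 / 2) powr d * (real (Suc m) powr d / real (Suc m)) \<le> real m powr d / real (Suc m)"
    by (simp add: divide_right_mono)
  then have half: "(1 / 2) powr d * real (Suc m) powr (d - 1) \<le> real m powr d / real (Suc m)"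
    by (simp add: powr_diff)
  have "n powr (d - 1) = (n / real (Suc m)) powr (d - 1) * real (Suc m) powr (d - 1)"
    using assms by (simp flip: powr_mult)
  also have "\<dots> \<le> (n / real (Suc m)) powr (d - \<epsilon>) * real (Suc m) powr (d - 1)"
    using assms by (intro mult_right_mono powr_mono) auto
  finally have "n powr (d - 1) * (1 / 2) powr d
      \<le> (n / real (Suc m)) powr (d - \<epsilon>) * ((1 / 2) powr d * real (Suc m) powr (d - 1))"
    by (simp add: mult_right_mono mult_ac)
  also have "\<dots> \<le> (n / real (Suc m)) powr (d - \<epsilon>) * (real m powr d / real (Suc m))"
    by (rule mult_left_mono[OF half]) simp
  finally show ?thesis .
qed

theorem lemma3p7:
  fixes V :: "'a set" and E :: "'a set set"
    and d c_reg C_reg C_riso C_W :: real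
    and N1 N2 :: "'a \<Rightarrow> nat"
    and S :: "'a \<Rightarrow> nat \<Rightarrow> 'a set"
  assumes graph: "simple_graph V E"
    and infinite_graph: "infinite V"
    and connected_graph: "connected_in E V"
    and locally_finite: "locally_finite_graph V E"
    and dim: "d \<ge> 2"
    and constants: "c_reg > 0" "C_reg > 0" "C_riso > 0" "C_W \<ge> 1"
    and volume_regularity:
      "\<And>x n. x \<in> V \<Longrightarrow> n \<ge> 1 \<Longrightarrow> n \<ge> N1 x \<Longrightarrow>
         c_reg * real n powr d \<le> real (card (graph_ball V E x (real n))) \<and>
         real (card (graph_ball V E x (real n))) \<le> C_reg * real n powr d"
    and S_connected: "\<And>x n. x \<in> V \<Longrightarrow> n \<ge> 1 \<Longrightarrow> S x n \<subseteq> V \<and> connected_in E (S x n)"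
    and S_increasing: "\<And>x. x \<in> V \<Longrightarrow> mono_on {1..} (S x)"
    and S_balls:
      "\<And>x n. x \<in> V \<Longrightarrow> n \<ge> 1 \<Longrightarrow> n \<ge> N2 x \<Longrightarrow>
         graph_ball V E x (real n) \<subseteq> S x n \<and> S x n \<subseteq> graph_ball V E x (C_W * real n)"
    and relative_isoperimetry:
      "\<And>x n A. x \<in> V \<Longrightarrow> n \<ge> 1 \<Longrightarrow> n \<ge> N2 x \<Longrightarrow> A \<subseteq> S x n \<Longrightarrow>
         real (card A) \<le> 1 / 2 * real (card (S x n)) \<Longrightarrow>
         real (card (rel_boundary E (S x n) A)) \<ge> C_riso * (1 / real n) * real (card A)"
  shows "\<forall>\<epsilon>::real. 0 < \<epsilon> \<and> \<epsilon> < 1 \<longrightarrow>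
    (\<exists>C2::real. C2 > 0 \<and>
      (\<forall>x\<in>V. \<forall>n::nat. \<forall>w :: 'a set \<Rightarrow> real.
         n \<ge> 1 \<and>
         \<lfloor>real n powr ((1 - \<epsilon>) / (d - \<epsilon>))\<rfloor> \<ge> int (max (N1 x) (N2 x)) \<and>
         (\<forall>e\<in>E. w e > 0) \<and>
         (\<forall>y y'. {y, y'} \<in> E \<longrightarrow>
            w {y, y'} \<ge>
              (real n / real (max (graph_dist E x y) (graph_dist E x y'))) powr (d - \<epsilon>))
         \<longrightarrow>
         (\<forall>A. A \<subseteq> S x n - {x} \<longrightarrow>
            rel_boundary_weight w E (S x n) A \<ge> C2 / real n * real (card A))))"
proof (intro allI impI, elim conjE)
  fix \<epsilon> :: real
  assume eps: "0 < \<epsilon>" "\<epsilon> < 1"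
  \<comment> \<open>\<open>K\<close> is the loss in edge weights from distances up to
    \<open>C_W * m\<close> in \<open>S x m\<close>, and \<open>M * n powr d\<close> bounds the
    volume of \<open>S x n\<close>. The two entries of \<open>min\<close> in \<open>L\<close> serve
    the cases \<open>m = k\<close> and \<open>m > k\<close> of the overview; those in
    \<open>C2\<close> serve small and large \<open>A\<close>. None of these constants depends on
    \<open>x\<close>, \<open>n\<close> or \<open>w\<close>.\<close>
  define K where "K = (1 / C_W) powr (d - \<epsilon>)"
  define M where "M = C_reg * (2 * C_W) powr d"
  define L where "L = K * min 1 (C_riso * c_reg / 2 * (1 / 2) powr d)"
  define C2 where "C2 = min (K * C_riso) (L / M)"
  have K: "K > 0" and M: "M > 0" and L: "L > 0"
    using constants by (auto simp: K_def M_def L_def)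
  then have C2: "C2 > 0"
    using constants by (simp add: C2_def)
  have "rel_boundary_weight w E (S x n) A \<ge> C2 / real n * real (card A)"
    if x: "x \<in> V" and n: "n \<ge> 1"
      and scale: "\<lfloor>real n powr ((1 - \<epsilon>) / (d - \<epsilon>))\<rfloor> \<ge> int (max (N1 x) (N2 x))"
      and w_pos: "\<forall>e\<in>E. w e > 0"
      and w_ge: "\<forall>y y'. {y, y'} \<in> E \<longrightarrow> w {y, y'} \<ge>
        (real n / real (max (graph_dist E x y) (graph_dist E x y'))) powr (d - \<epsilon>)"
      and A: "A \<subseteq> S x n - {x}"
    for x n A and w :: "'a set \<Rightarrow> real"
  proof -

    \<comment> \<open>Volume, finiteness and isoperimetry at scales from \<open>k\<close>
      onwards\<close>
    define k where "k = nat \<lfloor>real n powr ((1 - \<epsilon>) / (d - \<epsilon>))\<rfloor>"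
    have "real n powr ((1 - \<epsilon>) / (d - \<epsilon>)) \<ge> 1"
      using n eps dim by (intro ge_one_powr_ge_zero) auto
    then have k1: "k \<ge> 1"
      by (simp add: k_def le_nat_iff)
    have k_le_powr: "real k \<le> real n powr ((1 - \<epsilon>) / (d - \<epsilon>))"
      using k1 unfolding k_def by linarith
    also have "\<dots> \<le> real n powr 1"
      using n eps dim by (intro powr_mono) auto
    finally have kn: "k \<le> n"
      by simp
    have k_ge: "N1 x \<le> k" "N2 x \<le> k"
      using scale by (auto simp: k_def)
    have S_mono: "S x i \<subseteq> S x j" if "1 \<le> i" "i \<le> j" for i j
      using that by (intro mono_onD[OF S_increasing[OF x]]) auto
    have S_ball: "graph_ball V E x (real m) \<subseteq> S x m"
        "S x m \<subseteq> graph_ball V E x (C_W * real m)" if "k \<le> m" for m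
      using S_balls[OF x, of m] that k1 k_ge by auto
    have ball_card: "c_reg * real m powr d \<le> real (card (graph_ball V E x (real m)))"
        "real (card (graph_ball V E x (real m))) \<le> C_reg * real m powr d" if "k \<le> m" for m
      using volume_regularity[OF x, of m] that k1 k_ge by auto
    \<comment> \<open>An infinite set has \<open>card\<close> 0, so the positive lower volume bound
      forces finiteness.\<close>
    have ball_finite: "finite (graph_ball V E x (real m))" if "k \<le> m" for m
    proof -
      have "0 < c_reg * real m powr d"
        using constants that k1 by simp
      with ball_card(1)[OF that] show ?thesis
        by (metis card_gt_0_iff less_le_trans of_nat_0_less_iff)
    qed
    \<comment> \<open>The radius is rounded up to a natural number because volume regularity is
      stated only for such radii.\<close>
    have S_ball_ceiling: "S x m \<subseteq> graph_ball V E x (real (nat \<lceil>C_W * real m\<rceil>))" if "k \<le> m" for m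
      using S_ball(2)[OF that] graph_ball_mono[OF of_nat_ceiling] by (rule order.trans)
    have ceiling_ge: "m \<le> nat \<lceil>C_W * real m\<rceil>" for m
    proof -
      have "1 * real m \<le> C_W * real m"
        using constants by (intro mult_right_mono) auto
      then show ?thesis
        by linarith
    qed
    have S_finite: "finite (S x m)" if "k \<le> m" for m
      using S_ball_ceiling[OF that] ball_finite[OF order.trans[OF that ceiling_ge]]
      by (rule finite_subset)
    have x_in_S: "x \<in> S x m" if "k \<le> m" for m
    proof -
      have "graph_dist E x x = 0"
        unfolding graph_dist_def by (rule Least_eq_0) simp
      then show ?thesis
        using S_ball(1)[OF that] x by (auto simp: graph_ball_def)
    qed
    have isop: "real (card (rel_boundary E (S x m) D)) \<ge> C_riso * (1 / real m) * real (card D)"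
      if "k \<le> m" "D \<subseteq> S x m" "real (card D) \<le> 1 / 2 * real (card (S x m))" for m D
      using relative_isoperimetry[OF x, of m D] that k1 k_ge by auto
    have weight: "rel_boundary_weight w E (S x n) B
        \<ge> K * (real n / real m) powr (d - \<epsilon>) * real (card (rel_boundary E (S x m) (S x m \<inter> B)))"
      if m: "k \<le> m" "m \<le> n" and B: "B \<subseteq> S x n" for m B
    proof (rule rel_boundary_weight_ge_card)
      fix y y'
      assume e: "{y, y'} \<in> E" "y \<in> S x m" "y' \<in> S x m"
      let ?r = "max (graph_dist E x y) (graph_dist E x y')"
      have "y \<noteq> y'" "y \<in> V" "y' \<in> V"
        using e(1) graph unfolding simple_graph_def by force+
      \<comment> \<open>At least one endpoint differs from \<open>x\<close>. With
        \<open>?r = 0\<close> the quotient by \<open>?r\<close> would default to 0 and the assumed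
        bound on \<open>w\<close> would say nothing useful.\<close>
      then have r_pos: "?r > 0"
        using graph_dist_pos[OF connected_graph x] by (metis less_max_iff_disj)
      have r_le: "real ?r \<le> C_W * real m"
        using S_ball(2)[OF m(1)] e(2,3) by (auto simp: graph_ball_def le_floor_iff subset_iff max_def)
      have "K * (real n / real m) powr (d - \<epsilon>) = (real n / (C_W * real m)) powr (d - \<epsilon>)"
        using constants by (simp add: K_def flip: powr_mult)
      also have "\<dots> \<le> (real n / real ?r) powr (d - \<epsilon>)"
        using r_pos r_le eps dim constants m k1 by (intro powr_mono2 divide_left_mono) auto
      also have "\<dots> \<le> w {y, y'}"
        using w_ge e(1) by blast
      finally show "K * (real n / real m) powr (d - \<epsilon>) \<le> w {y, y'}" .
    qed (use S_finite kn B S_mono m k1 w_pos in auto)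
    show ?thesis
    proof (cases "real (card A) \<le> 1 / 2 * real (card (S x n))")
      case True
      have "C2 / real n * real (card A) \<le> K * C_riso / real n * real (card A)"
        by (intro mult_right_mono divide_right_mono) (auto simp: C2_def)
      also have "\<dots> = K * (C_riso * (1 / real n) * real (card A))"
        by simp
      also have "\<dots> \<le> K * real (card (rel_boundary E (S x n) A))"
        using K A by (intro mult_left_mono isop[OF kn _ True]) auto
      \<comment> \<open>The ratio 1 is inserted to match \<open>weight\<close> at the scale
        \<open>m = n\<close>.\<close>
      also have "\<dots> = K * (real n / real n) powr (d - \<epsilon>)
          * real (card (rel_boundary E (S x n) (S x n \<inter> A)))"
        using n A by (simp add: Int_absorb1 subset_Diff_insert)
      also have "\<dots> \<le> rel_boundary_weight w E (S x n) A"
        using A kn by (intro weight) auto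
      finally show ?thesis .
    next
      case False
      define B where "B = S x n - A"
      let ?b = "\<lambda>m. real (card (S x m \<inter> B))"
      let ?sparse = "\<lambda>m. ?b m \<le> 1 / 2 * real (card (S x m))"
      have B: "B \<subseteq> S x n" and xB: "x \<in> B"
        using A x_in_S[OF kn] by (auto simp: B_def)
      have AS: "A \<subseteq> S x n" and disj: "A \<inter> B = {}" and un: "A \<union> B = S x n"
        using A by (auto simp: B_def)
      have "card A + card B = card (S x n)"
        using card_Un_disjoint[OF _ _ disj] finite_subset[OF AS] finite_subset[OF B]
          S_finite[OF kn] un by simp
      then have "?sparse n"
        using False B by (simp add: Int_absorb1)
      with kn have "rel_boundary_weight w E (S x n) B \<ge> L * real n powr (d - 1)"
      proof (cases rule: first_sparse_scale[where P = ?sparse])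
        case 1
        \<comment> \<open>Because \<open>x\<close> lies in \<open>B\<close>, the isoperimetric bound
          is strictly positive, and an integer cardinality is then at least 1.\<close>
        have "S x k \<inter> B \<noteq> {}" "finite (S x k \<inter> B)"
          using x_in_S[of k] xB S_finite[of k] by auto
        then have "0 < C_riso * (1 / real k) * ?b k"
          using constants k1 by (simp add: card_gt_0_iff)
        also have "\<dots> \<le> real (card (rel_boundary E (S x k) (S x k \<inter> B)))"
          using 1 by (intro isop) auto
        finally have edge: "1 \<le> real (card (rel_boundary E (S x k) (S x k \<inter> B)))"
          by simp
        have "L * real n powr (d - 1) \<le> K * (real n / real k) powr (d - \<epsilon>)"
          using K L n k1 k_le_powr eps dim
          by (intro mult_mono powr_small_scale) (auto simp: L_def)
        also have "\<dots> * 1 \<le> K * (real n / real k) powr (d - \<epsilon>)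
            * real (card (rel_boundary E (S x k) (S x k \<inter> B)))"
          using K by (intro mult_left_mono edge) auto
        also have "\<dots> \<le> rel_boundary_weight w E (S x n) B"
          using kn B by (intro weight) auto
        finally show ?thesis
          by simp
      next
        case (2 m)
        \<comment> \<open>Here \<open>m\<close> is the last scale before the sparse one, so
          \<open>Suc m\<close> is the \<open>m\<close> of the overview. Density at \<open>m\<close>
          gives the volume of \<open>B\<close>; sparsity at \<open>Suc m\<close> permits
          isoperimetry there.\<close>
        have "c_reg * real m powr d \<le> real (card (graph_ball V E x (real m)))"
          using 2 by (intro ball_card)
        also have "\<dots> \<le> real (card (S x m))"
          using S_ball(1) S_finite 2 by (simp add: card_mono)
        also have "\<dots> \<le> 2 * ?b m"
          using 2 by simp
        also have "\<dots> \<le> 2 * ?b (Suc m)"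
          using S_mono[of m "Suc m"] S_finite[of "Suc m"] 2 k1
          by (auto intro!: card_mono)
        finally have dense: "c_reg / 2 * real m powr d \<le> ?b (Suc m)"
          by simp
        have "C_riso * (1 / real (Suc m)) * (c_reg / 2 * real m powr d)
            \<le> C_riso * (1 / real (Suc m)) * ?b (Suc m)"
          using constants by (intro mult_left_mono dense) auto
        also have "\<dots> \<le> real (card (rel_boundary E (S x (Suc m)) (S x (Suc m) \<inter> B)))"
          using 2 by (intro isop) auto
        finally have edges: "C_riso * c_reg / 2 * (real m powr d / real (Suc m))
            \<le> real (card (rel_boundary E (S x (Suc m)) (S x (Suc m) \<inter> B)))"
          by (simp add: mult_ac)
        have "L * real n powr (d - 1)
            \<le> K * (C_riso * c_reg / 2 * (1 / 2) powr d) * real n powr (d - 1)"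
          using K unfolding L_def by (intro mult_right_mono mult_left_mono) auto
        also have "\<dots> = K * (C_riso * c_reg / 2) * (real n powr (d - 1) * (1 / 2) powr d)"
          by simp
        also have "\<dots> \<le> K * (C_riso * c_reg / 2)
            * ((real n / real (Suc m)) powr (d - \<epsilon>) * (real m powr d / real (Suc m)))"
          using K constants 2 k1 eps dim by (intro mult_left_mono powr_large_scale) auto
        also have "\<dots> = K * (real n / real (Suc m)) powr (d - \<epsilon>)
            * (C_riso * c_reg / 2 * (real m powr d / real (Suc m)))"
          by simp
        also have "\<dots> \<le> K * (real n / real (Suc m)) powr (d - \<epsilon>)
            * real (card (rel_boundary E (S x (Suc m)) (S x (Suc m) \<inter> B)))"
          using K by (intro mult_left_mono edges) auto
        also have "\<dots> \<le> rel_boundary_weight w E (S x n) B"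
          using 2 B by (intro weight) auto
        finally show ?thesis .
      qed
      then have lower: "L * real n powr (d - 1) \<le> rel_boundary_weight w E (S x n) A"
        by (simp add: B_def rel_boundary_weight_def rel_boundary_compl[OF AS])
      \<comment> \<open>For large \<open>A\<close> the trivial bound by the volume of
        \<open>S x n\<close> suffices, as the boundary weight is already of order
        \<open>n powr (d - 1)\<close>.\<close>
      have "real (card A) \<le> real (card (graph_ball V E x (real (nat \<lceil>C_W * real n\<rceil>))))"
        using AS S_ball_ceiling[OF kn] ball_finite[OF order.trans[OF kn ceiling_ge]]
        by (intro of_nat_mono card_mono) auto
      also have "\<dots> \<le> C_reg * real (nat \<lceil>C_W * real n\<rceil>) powr d"
        using ball_card(2)[OF order.trans[OF kn ceiling_ge]] .
      also have "\<dots> \<le> C_reg * (2 * C_W * real n) powr d"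
      proof -
        \<comment> \<open>Rounding up adds less than 1, hence at most doubles a radius that is at
          least 1; this is the factor 2 in \<open>M\<close>.\<close>
        have "1 \<le> C_W * real n"
          using constants n mult_mono[of 1 C_W 1 "real n"] by simp
        then have "real (nat \<lceil>C_W * real n\<rceil>) \<le> 2 * C_W * real n"
          by linarith
        then show ?thesis
          using constants dim by (intro mult_left_mono powr_mono2 of_nat_0_le_iff) auto
      qed
      also have "\<dots> = M * real n powr d"
        using constants by (simp add: M_def powr_mult)
      finally have card_A: "real (card A) \<le> M * real n powr d" .
      have "C2 / real n * real (card A) \<le> (L / M) / real n * (M * real n powr d)"
        using card_A L M n by (intro mult_mono divide_right_mono) (auto simp: C2_def)
      also have "\<dots> = L * real n powr (d - 1)"
        using M n by (simp add: powr_diff)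
      finally show ?thesis
        using lower by linarith
    qed
  qed
  with C2 show "\<exists>C2::real. C2 > 0 \<and>
      (\<forall>x\<in>V. \<forall>n::nat. \<forall>w :: 'a set \<Rightarrow> real.
         n \<ge> 1 \<and>
         \<lfloor>real n powr ((1 - \<epsilon>) / (d - \<epsilon>))\<rfloor> \<ge> int (max (N1 x) (N2 x)) \<and>
         (\<forall>e\<in>E. w e > 0) \<and>
         (\<forall>y y'. {y, y'} \<in> E \<longrightarrow>
            w {y, y'} \<ge>
              (real n / real (max (graph_dist E x y) (graph_dist E x y'))) powr (d - \<epsilon>))
         \<longrightarrow>
         (\<forall>A. A \<subseteq> S x n - {x} \<longrightarrow>
            rel_boundary_weight w E (S x n) A \<ge> C2 / real n * real (card A)))"
    by (intro exI[of _ C2] conjI ballI allI impI) (assumption, elim conjE, blast)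
qed

end
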